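(* Let $d\geq 3$ and $n\geq (2^d-2/\ln 2)^2$ be integers. Then every family $\mathcal{F}\subseteq 2^{[n]}$ containing no $d$-dimensional Boolean algebra satisfies $$h_n(\mathcal{F})\leq 2(n+1)^{1-2^{1-d}}.$$
   Context: Let $[n]=\{1,2,\ldots,n\}$ and let $2^{[n]}$ denote the power set of $[n]$. A collection $\mathcal{B}\subseteq 2^{[n]}$ forms a $d$-dimensional Boolean algebra if there exist pairwise disjoint sets $X_0,X_1,\ldots,X_d\subseteq[n]$, all non-empty with perhaps the exception of $X_0$, such that $\mathcal{B}=\{X_0\cup\bigcup_{i\in I}X_i : I\subseteq[d]\}$. A family $\mathcal{F}$ contains a $d$-dimensional Boolean algebra if some subcollection of $\mathcal{F}$ is a $d$-dimensional Boolean algebra. The Lubell function of a family $\mathcal{F}\subseteq 2^{[n]}$ is $h_n(\mathcal{F}):=\sum_{F\in\mathcal{F}}\frac{1}{\binom{n}{|F|}}$. *)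

theory Defs
  imports Complex_Main "HOL-Library.Disjoint_Sets"
begin

definition boolean_algebra_of_dim :: "nat \<Rightarrow> nat \<Rightarrow> nat set set \<Rightarrow> bool" where
  "boolean_algebra_of_dim n d B \<longleftrightarrow>
     (\<exists>X :: nat \<Rightarrow> nat set.
        (\<forall>i\<in>{0..d}. X i \<subseteq> {1..n}) \<and>
        disjoint_family_on X {0..d} \<and>
        (\<forall>i\<in>{1..d}. X i \<noteq> {}) \<and>
        B = {X 0 \<union> (\<Union>i\<in>I. X i) | I. I \<subseteq> {1..d}})"

definition contains_boolean_algebra :: "nat \<Rightarrow> nat \<Rightarrow> nat set set \<Rightarrow> bool" where
  "contains_boolean_algebra n d F \<longleftrightarrow> (\<exists>B. B \<subseteq> F \<and> boolean_algebra_of_dim n d B)"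

definition lubell :: "nat \<Rightarrow> nat set set \<Rightarrow> real" where
  "lubell n F = (\<Sum>A\<in>F. 1 / real (n choose card A))"

end

theory Submission
  imports Defs "HOL-Library.Indicator_Function"
begin

text \<open>
  The Lubell function of \<open>F\<close> is the expected number \<open>h\<close> of members of \<open>F\<close> on a random maximal
  chain of the power set. If \<open>h\<close> is large, then by convexity the chain contains many pairs
  \<open>A \<subset> B\<close> of members of \<open>F\<close>: their expected number is at least \<open>h * (h - 1) / 2\<close>
  (\<open>expected_chain_sum_square_le\<close>).

  Group the pairs by their difference \<open>S = B - A\<close>. The sets \<open>A\<close> that occur with a given \<open>S\<close> form
  the link of \<open>S\<close>, a family on the complement of \<open>S\<close>, and their contribution is a multiple of the
  Lubell function of the link (\<open>sum_strict_pairs_by_difference\<close>). A \<open>d\<close>-dimensional Boolean algebra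
  in the link becomes a \<open>(d + 1)\<close>-dimensional one in \<open>F\<close> on adjoining \<open>S\<close> as a new direction
  (\<open>has_cube_Suc_if_link\<close>). So if \<open>c m\<close> bounds the Lubell function in dimension \<open>d\<close> on \<open>m\<close> points,
  then \<open>h * (h - 1) \<le> 2 * (\<Sum>m<n. c m)\<close> in dimension \<open>d + 1\<close> on \<open>n\<close> points
  (\<open>expected_chain_sum_cube_free_recursion\<close>).

  Starting from families without any member, the recursion yields the bound 1 in dimension 1 and
  then \<open>2 * sqrt (n + 1)\<close> in dimension 2. From there on it reproduces bounds of the form
  \<open>2 * (n + 1) powr (1 - e)\<close> with \<open>e\<close> halved at each step (\<open>cube_free_bound_Suc\<close>): roughly,
  summation raises the exponent \<open>1 - 2 * e\<close> by one, and solving the quadratic inequality for \<open>h\<close>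
  halves the result.
\<close>


section \<open>Sums over a random maximal chain\<close>

text \<open>
  The sets of a given size are equally likely to be the member of that size of a uniformly random
  maximal chain of \<open>Pow V\<close>. Hence this is the expectation of the sum of \<open>f\<close> over the members of
  such a chain; the weights stand in for the probability space.
\<close>

definition expected_chain_sum :: "('a set \<Rightarrow> real) \<Rightarrow> 'a set \<Rightarrow> real" where
  "expected_chain_sum f V = (\<Sum>A\<in>Pow V. f A / real (card V choose card A))"

lemma expected_chain_sum_split_top:
  assumes "finite V"
  shows "expected_chain_sum f V = f V + (\<Sum>A\<in>Pow V - {V}. f A / real (card V choose card A))"
  using assms by (simp add: expected_chain_sum_def sum.remove[of "Pow V" V])

text \<open>
  The first step down the random chain removes a uniformly random element \<open>v\<close> of \<open>V\<close>; what
  remains is a random chain in \<open>V - {v}\<close>. In terms of weights, a proper subset \<open>A\<close> of \<open>V\<close>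
  survives exactly the \<open>n - |A|\<close> removals of elements outside \<open>A\<close>, and
  \<open>(n - |A|) / (n - 1 choose |A|) = n / (n choose |A|)\<close>.
\<close>

lemma expected_chain_sum_step:
  assumes V: "finite V" "V \<noteq> {}"
  shows "expected_chain_sum f V = f V + (\<Sum>v\<in>V. expected_chain_sum f (V - {v})) / real (card V)"
proof -
  define n where "n = card V"
  have n: "n > 0" using V by (simp add: n_def card_gt_0_iff)
  have Pow_delete: "Pow (V - {v}) = {A \<in> Pow V - {V}. v \<notin> A}" if "v \<in> V" for v
    using that by auto
  have "(\<Sum>v\<in>V. expected_chain_sum f (V - {v}))
      = (\<Sum>v\<in>V. \<Sum>A | A \<in> Pow V - {V} \<and> v \<notin> A. f A / real ((n - 1) choose card A))"
    by (rule sum.cong) (use V in \<open>simp_all add: expected_chain_sum_def n_def Pow_delete\<close>)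
  also have "\<dots> = (\<Sum>A\<in>Pow V - {V}. \<Sum>v | v \<in> V \<and> v \<notin> A. f A / real ((n - 1) choose card A))"
    by (rule sum.swap_restrict) (use V in auto)
  also have "\<dots> = (\<Sum>A\<in>Pow V - {V}. real n * (f A / real (n choose card A)))"
  proof (rule sum.cong)
    fix A assume A: "A \<in> Pow V - {V}"
    then have fin: "finite A" using V finite_subset by auto
    have less: "card A < n"
      using A V psubset_card_mono[of V A] by (auto simp: n_def)
    have "{v. v \<in> V \<and> v \<notin> A} = V - A" by auto
    then have card: "card {v. v \<in> V \<and> v \<notin> A} = n - card A"
      using A fin by (simp add: card_Diff_subset n_def)
    have "real (n - card A) * real (n choose card A) = real n * real ((n - 1) choose card A)"
      by (metis binomial_absorb_comp of_nat_mult)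
    moreover have "card A \<le> n - 1" using less by simp
    ultimately have "real (n - card A) / real ((n - 1) choose card A) = real n / real (n choose card A)"
      using less by (simp add: frac_eq_eq)
    then have "real (n - card A) / real ((n - 1) choose card A) * f A = real n / real (n choose card A) * f A"
      by simp
    then show "(\<Sum>v | v \<in> V \<and> v \<notin> A. f A / real ((n - 1) choose card A))
        = real n * (f A / real (n choose card A))"
      by (simp add: card)
  qed simp
  finally have "(\<Sum>v\<in>V. expected_chain_sum f (V - {v})) / real n
      = (\<Sum>A\<in>Pow V - {V}. f A / real (n choose card A))"
    using n by (simp only: sum_distrib_left[symmetric]) simp
  then show ?thesis
    using expected_chain_sum_split_top[OF V(1), of f] by (simp add: n_def)
qed

text \<open>
  This is the inequality between the squared mean and the second moment for the random
  variable \<open>X = \<Sum> f A\<close>, summed over the members \<open>A\<close> of the chain. Expanding \<open>X\<^sup>2\<close> and collecting the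
  products of pairs at their larger member \<open>B\<close> gives \<open>f B * (2 * T - f B)\<close>, where \<open>T\<close> is the
  part of the sum at and below \<open>B\<close>; below \<open>B\<close> the chain is again uniformly random, so \<open>T\<close> has
  mean \<open>expected_chain_sum f B\<close>.

  In the induction on \<open>V\<close>, the contributions of \<open>V\<close> itself are equal on both sides and
  leave the convexity inequality for the average of the values at the sets \<open>V - {v}\<close>.
\<close>

lemma expected_chain_sum_square_le:
  fixes f :: "'a set \<Rightarrow> real"
  assumes "finite V"
  shows "(expected_chain_sum f V)\<^sup>2
      \<le> expected_chain_sum (\<lambda>B. f B * (2 * expected_chain_sum f B - f B)) V"
  using assms
proof (induction "card V" arbitrary: V)
  case 0
  then show ?case by (simp add: expected_chain_sum_def power2_eq_square)
next
  case (Suc m)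
  define E where "E = expected_chain_sum f"
  define Q where "Q = expected_chain_sum (\<lambda>B. f B * (2 * E B - f B))"
  define n where "n = real (card V)"
  define K where "K = (\<Sum>v\<in>V. E (V - {v})) / n"
  have V: "V \<noteq> {}" and n: "n > 0" using Suc.hyps by (auto simp: n_def)
  have E: "E V = f V + K"
    unfolding E_def K_def n_def by (rule expected_chain_sum_step) (use Suc.prems V in auto)
  have Q: "Q V = f V * (2 * E V - f V) + (\<Sum>v\<in>V. Q (V - {v})) / n"
    unfolding Q_def n_def by (rule expected_chain_sum_step) (use Suc.prems V in auto)
  \<comment> \<open>The tangent to the square at the mean \<open>K\<close> lies below it; averaging over \<open>v\<close> gives \<open>K\<^sup>2\<close>.\<close>
  have "2 * K * E (V - {v}) - K\<^sup>2 \<le> Q (V - {v})" if "v \<in> V" for v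
  proof -
    have "(E (V - {v}))\<^sup>2 \<le> Q (V - {v})"
      unfolding E_def Q_def by (rule Suc.hyps(1)) (use Suc that in auto)
    moreover have "0 \<le> (E (V - {v}) - K)\<^sup>2" by simp
    ultimately show ?thesis by (simp add: power2_diff mult_ac)
  qed
  then have "(\<Sum>v\<in>V. 2 * K * E (V - {v}) - K\<^sup>2) \<le> (\<Sum>v\<in>V. Q (V - {v}))"
    by (rule sum_mono)
  moreover have "(\<Sum>v\<in>V. 2 * K * E (V - {v}) - K\<^sup>2) = n * K\<^sup>2"
  proof -
    have "(\<Sum>v\<in>V. E (V - {v})) = n * K" using n by (simp add: K_def)
    then show ?thesis
      by (simp add: sum_subtractf n_def power2_eq_square flip: sum_distrib_left)
  qed
  ultimately have "K\<^sup>2 \<le> (\<Sum>v\<in>V. Q (V - {v})) / n"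
    using n by (simp add: field_simps)
  then have "(E V)\<^sup>2 \<le> Q V"
    by (simp add: E Q power2_eq_square algebra_simps)
  then show ?case by (simp add: E_def Q_def)
qed

text \<open>
  A pair \<open>A \<subset> B\<close> lies on the chain with probability \<open>1 / ((n choose |B|) (|B| choose |A|))\<close>,
  the reciprocal of a trinomial coefficient. With \<open>S = B - A\<close> the trinomial coefficient also
  factors as \<open>(n choose |S|) (n - |S| choose |A|)\<close>, and for fixed \<open>S\<close> the second factor is the
  one belonging to chains in \<open>V - S\<close>.
\<close>

lemma sum_strict_pairs_by_difference:
  fixes g :: "'a set \<Rightarrow> 'a set \<Rightarrow> real"
  assumes V: "finite V"
  shows "(\<Sum>B\<in>Pow V. (\<Sum>A\<in>Pow B - {B}. g A B / real (card B choose card A)) / real (card V choose card B))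
       = (\<Sum>S\<in>Pow V - {{}}. expected_chain_sum (\<lambda>A. g A (A \<union> S)) (V - S) / real (card V choose card S))"
proof -
  let ?n = "card V"
  have finV: "finite A" if "A \<subseteq> V" for A using that V finite_subset by auto
  have "(\<Sum>B\<in>Pow V. (\<Sum>A\<in>Pow B - {B}. g A B / real (card B choose card A)) / real (?n choose card B))
      = (\<Sum>(B, A)\<in>Sigma (Pow V) (\<lambda>B. Pow B - {B}).
           g A B / real (card B choose card A) / real (?n choose card B))"
    by (subst sum.Sigma[symmetric]) (use V finV in \<open>auto simp: sum_divide_distrib\<close>)
  also have "\<dots> = (\<Sum>(S, A)\<in>Sigma (Pow V - {{}}) (\<lambda>S. Pow (V - S)).
           g A (A \<union> S) / real (card (V - S) choose card A) / real (?n choose card S))"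
  proof (rule sum.reindex_bij_witness[where i = "\<lambda>(S, A). (A \<union> S, A)" and j = "\<lambda>(B, A). (B - A, A)"])
    fix p assume p: "p \<in> Sigma (Pow V) (\<lambda>B. Pow B - {B})"
    obtain B A where BA: "p = (B, A)" by (cases p)
    have AB: "A \<subseteq> B" "B \<subseteq> V" using p BA by auto
    have fin: "finite A" "finite B" using AB finV by auto
    have le: "card A \<le> card B" "card B \<le> ?n" using AB fin V card_mono by metis+
    have s: "card (B - A) = card B - card A" using AB fin card_Diff_subset by metis
    have c: "card (V - (B - A)) = ?n - (card B - card A)"
      using s AB fin card_Diff_subset[of "B - A" V] by auto
    have "(?n choose card B) * (card B choose card A)
        = (?n choose card B) * (card B choose (card B - card A))"
      using binomial_symmetric[OF le(1)] by simp
    also have "\<dots> = (?n choose (card B - card A)) * ((?n - (card B - card A)) choose card A)"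
      using choose_mult[of "card B - card A" "card B" ?n] le by simp
    finally have "real (?n choose card B) * real (card B choose card A)
        = real (?n choose card (B - A)) * real (card (V - (B - A)) choose card A)"
      unfolding s c by (metis of_nat_mult)
    moreover have "A \<union> (B - A) = B" using AB by auto
    ultimately show "(case case p of (B, A) \<Rightarrow> (B - A, A) of (S, A) \<Rightarrow>
            g A (A \<union> S) / real (card (V - S) choose card A) / real (?n choose card S))
        = (case p of (B, A) \<Rightarrow> g A B / real (card B choose card A) / real (?n choose card B))"
      by (simp add: BA mult.commute)
  qed auto
  also have "\<dots> = (\<Sum>S\<in>Pow V - {{}}. expected_chain_sum (\<lambda>A. g A (A \<union> S)) (V - S) / real (?n choose card S))"
    by (subst sum.Sigma[symmetric])
      (use V finV in \<open>auto simp: sum_divide_distrib expected_chain_sum_def\<close>)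
  finally show ?thesis .
qed

lemma sum_Pow_by_card:
  fixes \<phi> :: "nat \<Rightarrow> real"
  assumes "finite V"
  shows "(\<Sum>S\<in>Pow V. \<phi> (card S) / real (card V choose card S)) = (\<Sum>k\<le>card V. \<phi> k)"
proof -
  let ?n = "card V"
  have "(\<Sum>S\<in>Pow V. \<phi> (card S) / real (?n choose card S))
      = (\<Sum>k\<le>?n. \<Sum>S | S \<in> Pow V \<and> card S = k. \<phi> (card S) / real (?n choose card S))"
    by (rule sum.group[symmetric]) (use assms card_mono in auto)
  also have "\<dots> = (\<Sum>k\<le>?n. \<phi> k)"
  proof (rule sum.cong)
    fix k assume "k \<in> {..?n}"
    then show "(\<Sum>S | S \<in> Pow V \<and> card S = k. \<phi> (card S) / real (?n choose card S)) = \<phi> k"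
      using n_subsets[OF assms, of k] by simp
  qed simp
  finally show ?thesis .
qed

section \<open>Cubes and their links\<close>

text \<open>
  The ground set is left implicit here, because the induction on the dimension moves from
  \<open>V\<close> to \<open>V - S\<close>.
\<close>

definition has_cube :: "nat \<Rightarrow> 'a set set \<Rightarrow> bool" where
  "has_cube d F \<longleftrightarrow> (\<exists>X. disjoint_family_on X {0..d} \<and> (\<forall>i\<in>{1..d}. X i \<noteq> {}) \<and>
     (\<forall>I\<subseteq>{1..d}. X 0 \<union> (\<Union>i\<in>I. X i) \<in> F))"

text \<open>
  The blocks \<open>X i\<close> lie in the ground set because each is contained in the top element of the cube,
  which belongs to \<open>F\<close>.
\<close>

lemma contains_boolean_algebra_if_has_cube:
  assumes "has_cube d F" and F: "F \<subseteq> Pow {1..n}"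
  shows "contains_boolean_algebra n d F"
proof -
  obtain X where X: "disjoint_family_on X {0..d}" "\<forall>i\<in>{1..d}. X i \<noteq> {}"
      and in_F: "\<And>I. I \<subseteq> {1..d} \<Longrightarrow> X 0 \<union> (\<Union>i\<in>I. X i) \<in> F"
    using assms(1) unfolding has_cube_def by blast
  have "X i \<subseteq> {1..n}" if "i \<in> {0..d}" for i
  proof -
    have "X i \<subseteq> X 0 \<union> (\<Union>i\<in>{1..d}. X i)" using that by (cases "i = 0") auto
    then show ?thesis using in_F[of "{1..d}"] F by blast
  qed
  then have "boolean_algebra_of_dim n d {X 0 \<union> (\<Union>i\<in>I. X i) | I. I \<subseteq> {1..d}}"
    unfolding boolean_algebra_of_dim_def using X by blast
  moreover have "{X 0 \<union> (\<Union>i\<in>I. X i) | I. I \<subseteq> {1..d}} \<subseteq> F" using in_F by blast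
  ultimately show ?thesis unfolding contains_boolean_algebra_def by blast
qed

lemma has_cube_0_iff: "has_cube 0 F \<longleftrightarrow> F \<noteq> {}"
proof
  assume "F \<noteq> {}"
  then obtain A where "A \<in> F" by blast
  then show "has_cube 0 F"
    unfolding has_cube_def by (intro exI[of _ "\<lambda>_. A"]) (auto simp: disjoint_family_on_def)
qed (auto simp: has_cube_def)

text \<open>
  Each vertex of a cube in the link of \<open>S\<close> is in \<open>F\<close> both without and with \<open>S\<close> adjoined, so
  \<open>S\<close> serves as one more direction.
\<close>

lemma has_cube_Suc_if_link:
  assumes "S \<noteq> {}" and "has_cube d {A \<in> F. A \<inter> S = {} \<and> A \<union> S \<in> F}"
  shows "has_cube (Suc d) F"
proof -
  obtain X where disj: "disjoint_family_on X {0..d}" and ne: "\<forall>i\<in>{1..d}. X i \<noteq> {}"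
      and cube: "\<forall>I\<subseteq>{1..d}. X 0 \<union> (\<Union>i\<in>I. X i) \<in> {A \<in> F. A \<inter> S = {} \<and> A \<union> S \<in> F}"
    using assms(2) unfolding has_cube_def by (elim exE conjE)
  have link: "X 0 \<union> (\<Union>i\<in>I. X i) \<in> F \<and> (X 0 \<union> (\<Union>i\<in>I. X i)) \<inter> S = {} \<and> X 0 \<union> (\<Union>i\<in>I. X i) \<union> S \<in> F"
    if "I \<subseteq> {1..d}" for I
    using cube[rule_format, OF that] by (simp only: mem_Collect_eq)
  define Y where "Y = X(Suc d := S)"
  have S: "X i \<inter> S = {}" if "i \<in> {0..d}" for i
  proof -
    have "X i \<subseteq> X 0 \<union> (\<Union>i\<in>{1..d}. X i)" using that by (cases "i = 0") auto
    then show ?thesis using link[of "{1..d}"] by blast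
  qed
  have "disjoint_family_on Y {0..Suc d}"
    unfolding disjoint_family_on_def
  proof (intro ballI impI)
    fix i j assume "i \<in> {0..Suc d}" "j \<in> {0..Suc d}" "i \<noteq> j"
    then show "Y i \<inter> Y j = {}"
      using disj S[of i] S[of j]
      by (cases "i = Suc d"; cases "j = Suc d")
        (simp_all add: Y_def disjoint_family_on_def Int_commute)
  qed
  moreover have "\<forall>i\<in>{1..Suc d}. Y i \<noteq> {}"
    using ne assms(1) by (auto simp: Y_def)
  moreover have "Y 0 \<union> (\<Union>i\<in>I. Y i) \<in> F" if I: "I \<subseteq> {1..Suc d}" for I
  proof -
    define J where "J = I - {Suc d}"
    have J: "J \<subseteq> {1..d}" using I by (auto simp: J_def le_Suc_eq)
    have old: "Y 0 \<union> (\<Union>i\<in>J. Y i) = X 0 \<union> (\<Union>i\<in>J. X i)"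
      by (auto simp: Y_def J_def)
    show ?thesis
    proof (cases "Suc d \<in> I")
      case True
      then have "I = insert (Suc d) J" by (auto simp: J_def)
      moreover have "Y (Suc d) = S" by (simp add: Y_def)
      ultimately have "Y 0 \<union> (\<Union>i\<in>I. Y i) = Y 0 \<union> (\<Union>i\<in>J. Y i) \<union> S" by auto
      then have "Y 0 \<union> (\<Union>i\<in>I. Y i) = X 0 \<union> (\<Union>i\<in>J. X i) \<union> S" by (simp only: old)
      then show ?thesis using link[OF J] by simp
    next
      case False
      then have "I = J" by (auto simp: J_def)
      then show ?thesis using old link[OF J] by simp
    qed
  qed
  ultimately show ?thesis unfolding has_cube_def by blast
qed

lemma lubell_eq_expected_chain_sum:
  assumes "F \<subseteq> Pow {1..n}"
  shows "lubell n F = expected_chain_sum (indicator F) {1..n}"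
proof -
  have "expected_chain_sum (indicator F) {1..n}
      = (\<Sum>A\<in>Pow {1..n}. if A \<in> F then 1 / real (n choose card A) else 0)"
    unfolding expected_chain_sum_def by (rule sum.cong) (auto simp: indicator_def)
  also have "\<dots> = (\<Sum>A\<in>Pow {1..n} \<inter> F. 1 / real (n choose card A))"
    by (rule sum.inter_restrict[symmetric]) simp
  finally show ?thesis using assms by (simp add: lubell_def Int_absorb1)
qed

section \<open>The recursion in the dimension\<close>

text \<open>
  The bound is uniform over all finite ground sets in the type, since bounding a family on \<open>V\<close>
  uses families on all smaller sets \<open>V - S\<close>. The type argument only fixes the type of the elements.
\<close>

definition cube_free_bound :: "'a itself \<Rightarrow> nat \<Rightarrow> (nat \<Rightarrow> real) \<Rightarrow> bool" where
  "cube_free_bound _ d c \<longleftrightarrow> (\<forall>(V :: 'a set) F. finite V \<longrightarrow> \<not> has_cube d F \<longrightarrow>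
     expected_chain_sum (indicator F) V \<le> c (card V))"

text \<open>
  The heart of the argument. Let \<open>h\<close> be the expected number of members of \<open>F\<close> on the chain. The
  second moment inequality bounds \<open>h * (h - 1)\<close> by twice the expected number of pairs \<open>A \<subset> B\<close> in
  \<open>F\<close> on the chain. Grouped by \<open>S = B - A\<close>, these pairs are counted by the links of the nonempty
  sets \<open>S\<close>, which contain no \<open>d\<close>-cube. The weights of the sets \<open>S\<close> of any given size add up to 1,
  so each size \<open>s\<close> contributes at most \<open>c (n - s)\<close>.
\<close>

lemma expected_chain_sum_cube_free_recursion:
  fixes V :: "'a set"
  assumes bound: "cube_free_bound TYPE('a) d c"
    and V: "finite V" and F: "\<not> has_cube (Suc d) F"
  shows "expected_chain_sum (indicator F) V * (expected_chain_sum (indicator F) V - 1)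
      \<le> 2 * (\<Sum>m<card V. c m)"
proof -
  define f :: "'a set \<Rightarrow> real" where "f = indicator F"
  define E where "E = expected_chain_sum f"
  define g where "g = (\<lambda>A B. f A * f B)"
  let ?n = "card V"
  have ff: "f A * f A = f A" for A by (simp add: f_def indicator_def)
  have finV: "finite A" if "A \<subseteq> V" for A using that V finite_subset by auto
  have "(E V)\<^sup>2 \<le> (\<Sum>B\<in>Pow V. f B * (2 * E B - f B) / real (?n choose card B))"
    using expected_chain_sum_square_le[OF V, of f]
    by (simp add: E_def expected_chain_sum_def[of "\<lambda>B. f B * (2 * expected_chain_sum f B - f B)"])
  also have "\<dots> = (\<Sum>B\<in>Pow V. f B / real (?n choose card B)
      + 2 * ((\<Sum>A\<in>Pow B - {B}. g A B / real (card B choose card A)) / real (?n choose card B)))"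
  proof (rule sum.cong)
    fix B assume "B \<in> Pow V"
    define R where "R = (\<Sum>A\<in>Pow B - {B}. f A / real (card B choose card A))"
    have "E B = f B + R"
      using \<open>B \<in> Pow V\<close> finV unfolding E_def R_def by (simp add: expected_chain_sum_split_top)
    then have "f B * (2 * E B - f B) = f B * f B + 2 * (f B * R)"
      by (simp add: algebra_simps)
    also have "f B * R = (\<Sum>A\<in>Pow B - {B}. g A B / real (card B choose card A))"
      by (simp add: R_def g_def sum_distrib_left mult.commute)
    finally show "f B * (2 * E B - f B) / real (?n choose card B) = f B / real (?n choose card B)
      + 2 * ((\<Sum>A\<in>Pow B - {B}. g A B / real (card B choose card A)) / real (?n choose card B))"
      by (simp add: ff add_divide_distrib)
  qed simp
  also have "\<dots> = E V + 2 * (\<Sum>S\<in>Pow V - {{}}.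
      expected_chain_sum (\<lambda>A. g A (A \<union> S)) (V - S) / real (?n choose card S))"
    unfolding sum.distrib sum_distrib_left[symmetric] sum_strict_pairs_by_difference[OF V]
    by (simp add: E_def expected_chain_sum_def[of f])
  also have "(\<Sum>S\<in>Pow V - {{}}. expected_chain_sum (\<lambda>A. g A (A \<union> S)) (V - S) / real (?n choose card S))
      \<le> (\<Sum>S\<in>Pow V - {{}}. c (?n - card S) / real (?n choose card S))"
  proof (rule sum_mono)
    fix S assume S: "S \<in> Pow V - {{}}"
    define L where "L = {A \<in> F. A \<inter> S = {} \<and> A \<union> S \<in> F}"
    have "\<not> has_cube d L" using has_cube_Suc_if_link[of S d F] F S by (auto simp: L_def)
    moreover have "expected_chain_sum (\<lambda>A. g A (A \<union> S)) (V - S) = expected_chain_sum (indicator L) (V - S)"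
      unfolding expected_chain_sum_def
      by (rule sum.cong) (auto simp: g_def f_def L_def indicator_def)
    moreover have "card (V - S) = ?n - card S"
      using S finV card_Diff_subset[of S V] by auto
    ultimately have "expected_chain_sum (\<lambda>A. g A (A \<union> S)) (V - S) \<le> c (?n - card S)"
      using bound V unfolding cube_free_bound_def by (metis finite_Diff)
    then show "expected_chain_sum (\<lambda>A. g A (A \<union> S)) (V - S) / real (?n choose card S)
        \<le> c (?n - card S) / real (?n choose card S)"
      by (simp add: divide_right_mono)
  qed
  also have "(\<Sum>S\<in>Pow V - {{}}. c (?n - card S) / real (?n choose card S)) = (\<Sum>m<?n. c m)"
  proof -
    \<comment> \<open>Setting \<open>\<phi> 0 = 0\<close> lets the sum run over all of \<open>Pow V\<close>, the empty difference included.\<close>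
    define \<phi> where "\<phi> k = (if k = 0 then 0 else c (?n - k))" for k
    have "(\<Sum>S\<in>Pow V - {{}}. c (?n - card S) / real (?n choose card S))
        = (\<Sum>S\<in>Pow V - {{}}. \<phi> (card S) / real (?n choose card S))"
      by (rule sum.cong) (use finV in \<open>auto simp: \<phi>_def\<close>)
    also have "\<dots> = (\<Sum>S\<in>Pow V. \<phi> (card S) / real (?n choose card S))"
      by (rule sum.mono_neutral_left) (use V in \<open>auto simp: \<phi>_def\<close>)
    also have "\<dots> = (\<Sum>k\<le>?n. \<phi> k)" by (rule sum_Pow_by_card[OF V])
    also have "\<dots> = \<phi> 0 + (\<Sum>k<?n. \<phi> (Suc k))" by (rule sum.atMost_shift)
    also have "\<dots> = (\<Sum>k<?n. c (?n - Suc k))" by (simp add: \<phi>_def)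
    also have "\<dots> = (\<Sum>m<?n. c m)" by (rule sum.nat_diff_reindex)
    finally show ?thesis .
  qed
  finally show ?thesis
    by (simp add: E_def f_def power2_eq_square algebra_simps)
qed

section \<open>Solving the recursion\<close>

text \<open>
  Turns a bound on \<open>h * (h - 1)\<close> into one on \<open>h\<close>: the function \<open>x * (x - 1)\<close> is increasing for
  \<open>x \<ge> 1\<close>.
\<close>

lemma le_if_mult_pred_le:
  fixes h x :: real
  assumes "h * (h - 1) \<le> x * (x - 1)" "x \<ge> 1"
  shows "h \<le> x"
proof (rule ccontr)
  assume "\<not> h \<le> x"
  then have "x * (x - 1) < h * (h - 1)" using assms(2) by (intro mult_strict_mono') auto
  then show False using assms(1) by simp
qed

text \<open>
  Comparison of the sum with the integral of \<open>x powr a\<close>, done one unit interval at a time by the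
  mean value theorem.
\<close>

lemma sum_powr_le:
  fixes a :: real
  assumes "a \<ge> 0"
  shows "(\<Sum>m<n. (real m + 1) powr a) \<le> (real n + 1) powr (a + 1) / (a + 1)"
proof (induction n)
  case (Suc n)
  have "\<exists>z. real n + 1 < z \<and> z < real n + 2 \<and>
      (real n + 2) powr (a + 1) - (real n + 1) powr (a + 1)
        = (real n + 2 - (real n + 1)) * ((a + 1) * z powr (a + 1 - 1))"
    by (rule MVT2) (simp, rule has_real_derivative_powr, simp)
  then obtain z where z: "real n + 1 < z"
    and eq: "(real n + 2) powr (a + 1) - (real n + 1) powr (a + 1) = (a + 1) * z powr a" by auto
  have "(real n + 1) powr a \<le> z powr a" using z assms by (intro powr_mono2) auto
  also have "z powr a = ((real n + 2) powr (a + 1) - (real n + 1) powr (a + 1)) / (a + 1)"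
    unfolding eq using assms by simp
  finally have "(real n + 1) powr a + (real n + 1) powr (a + 1) / (a + 1) \<le> (real n + 2) powr (a + 1) / (a + 1)"
    by (simp add: diff_divide_distrib)
  then show ?case using Suc.IH by (simp add: add.commute)
qed (use assms in simp)

lemma cube_free_bound_0: "cube_free_bound TYPE('a) 0 (\<lambda>_. 0)"
  by (auto simp: cube_free_bound_def has_cube_0_iff expected_chain_sum_def)

text \<open>
  A family without a 1-dimensional cube is an antichain, so this is the LYM inequality.
\<close>

lemma cube_free_bound_1: "cube_free_bound TYPE('a) 1 (\<lambda>_. 1)"
  unfolding cube_free_bound_def
proof (intro allI impI)
  fix V :: "'a set" and F :: "'a set set" assume V: "finite V" and F: "\<not> has_cube 1 F"
  show "expected_chain_sum (indicator F) V \<le> 1"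
  proof (rule le_if_mult_pred_le)
    show "expected_chain_sum (indicator F) V * (expected_chain_sum (indicator F) V - 1) \<le> 1 * (1 - 1)"
      using expected_chain_sum_cube_free_recursion[OF cube_free_bound_0 V, of F] F by simp
  qed simp
qed

text \<open>
  The induction on the dimension starts here. The step \<open>cube_free_bound_Suc\<close> below loses a factor
  \<open>1 / (2 - 2 * e)\<close>, which would be 1 in dimension 2, where \<open>e = 1 / 2\<close>, and leave no room for
  the term \<open>- h\<close> in \<open>h * (h - 1)\<close>. The bound 1 for antichains, half of what the general formula
  gives in dimension 1, provides that room.
\<close>

lemma cube_free_bound_2:
  "cube_free_bound TYPE('a) 2 (\<lambda>n. 2 * (real n + 1) powr (1 / 2))"
  unfolding cube_free_bound_def
proof (intro allI impI)
  fix V :: "'a set" and F :: "'a set set" assume V: "finite V" and F: "\<not> has_cube 2 F"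
  define h where "h = expected_chain_sum (indicator F) V"
  define s where "s = sqrt (real (card V) + 1)"
  have "h * (h - 1) \<le> 2 * real (card V)"
    using expected_chain_sum_cube_free_recursion[OF cube_free_bound_1 V, of F] F
    by (simp add: h_def numeral_2_eq_2)
  also have "\<dots> \<le> 2 * s * (2 * s - 1)"
  proof -
    have "s\<^sup>2 = real (card V) + 1" by (simp add: s_def)
    then show ?thesis
      using zero_le_power2[of "s - 1"] by (simp add: power2_eq_square algebra_simps)
  qed
  finally have "h * (h - 1) \<le> 2 * s * (2 * s - 1)" .
  moreover have "s \<ge> 1" by (simp add: s_def)
  then have "2 * s \<ge> 1" by simp
  ultimately have "h \<le> 2 * s" by (rule le_if_mult_pred_le)
  then show "expected_chain_sum (indicator F) V \<le> 2 * (real (card V) + 1) powr (1 / 2)"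
    by (simp add: h_def s_def powr_half_sqrt)
qed

text \<open>
  With \<open>x = 2 * (n + 1) powr (1 - e)\<close>, the recursion and the integral comparison give
  \<open>h * (h - 1) \<le> x\<^sup>2 / (2 - 2 * e) \<le> 2 / 3 * x\<^sup>2\<close>, since \<open>e \<le> 1 / 4\<close>. The right-hand side is at most
  \<open>x * (x - 1)\<close> as soon as \<open>x \<ge> 3\<close>, which holds for every nonempty ground set because
  \<open>2 * 2 powr (3 / 4) > 3\<close>.
\<close>

lemma cube_free_bound_Suc:
  fixes e :: real
  assumes bound: "cube_free_bound TYPE('a) d (\<lambda>n. 2 * (real n + 1) powr (1 - 2 * e))"
    and e: "0 \<le> e" "e \<le> 1 / 4"
  shows "cube_free_bound TYPE('a) (Suc d) (\<lambda>n. 2 * (real n + 1) powr (1 - e))"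
  unfolding cube_free_bound_def
proof (intro allI impI)
  fix V :: "'a set" and F :: "'a set set" assume V: "finite V" and F: "\<not> has_cube (Suc d) F"
  define h where "h = expected_chain_sum (indicator F) V"
  define n where "n = card V"
  define x where "x = 2 * (real n + 1) powr (1 - e)"
  have rec: "h * (h - 1) \<le> 2 * (\<Sum>m<n. 2 * (real m + 1) powr (1 - 2 * e))"
    unfolding h_def n_def by (rule expected_chain_sum_cube_free_recursion[OF bound V F])
  show "expected_chain_sum (indicator F) V \<le> 2 * (real (card V) + 1) powr (1 - e)"
    unfolding h_def[symmetric] n_def[symmetric] x_def[symmetric]
  proof (rule le_if_mult_pred_le)
    have "(real n + 1) powr (1 - e) \<ge> 1" using e by (intro ge_one_powr_ge_zero) auto
    then show "x \<ge> 1" by (simp add: x_def)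
    show "h * (h - 1) \<le> x * (x - 1)"
    proof (cases "n = 0")
      case True
      then show ?thesis using rec by (simp add: x_def)
    next
      case False
      have "h * (h - 1) \<le> 4 * (\<Sum>m<n. (real m + 1) powr (1 - 2 * e))"
        using rec by (simp flip: sum_distrib_left)
      also have "(\<Sum>m<n. (real m + 1) powr (1 - 2 * e))
          \<le> (real n + 1) powr (1 - 2 * e + 1) / (1 - 2 * e + 1)"
        by (rule sum_powr_le) (use e in simp)
      also have "(real n + 1) powr (1 - 2 * e + 1) = (x / 2)\<^sup>2"
        by (simp add: x_def power2_eq_square flip: powr_add)
      also have "(x / 2)\<^sup>2 / (1 - 2 * e + 1) \<le> (x / 2)\<^sup>2 / (3 / 2)"
        using e by (intro divide_left_mono) auto
      finally have upper: "h * (h - 1) \<le> 2 / 3 * x\<^sup>2" by (simp add: power2_eq_square)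
      have "x \<ge> 3"
      proof -
        \<comment> \<open>Comparing fourth powers: \<open>81 / 16 \<le> 8\<close>.\<close>
        have "(3 / 2) \<le> (2 :: real) powr (3 / 4)"
        proof (rule power_le_imp_le_base)
          have "((2 :: real) powr (3 / 4)) ^ Suc 3 = 8"
            by (simp add: powr_powr flip: powr_realpow)
          then show "(3 / 2) ^ Suc 3 \<le> ((2 :: real) powr (3 / 4)) ^ Suc 3"
            by (simp add: power_divide)
        qed simp
        also have "\<dots> \<le> (real n + 1) powr (3 / 4)" using False by (intro powr_mono2) auto
        also have "\<dots> \<le> (real n + 1) powr (1 - e)" using e by (intro powr_mono) auto
        finally show ?thesis by (simp add: x_def)
      qed
      then have "x * 3 \<le> x * x" by (intro mult_left_mono) auto
      then show ?thesis using upper by (simp add: power2_eq_square algebra_simps)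
    qed
  qed
qed

text \<open>
  The exponent deficit \<open>e = 2 powr (1 - d)\<close> is halved with each new dimension, and it is at most
  \<open>1 / 4\<close> from dimension 3 on.
\<close>

lemma cube_free_bound_ge_2:
  assumes "d \<ge> 2"
  shows "cube_free_bound TYPE('a) d (\<lambda>n. 2 * (real n + 1) powr (1 - 2 powr (1 - real d)))"
  using assms
proof (induction d rule: dec_induct)
  case base
  have "(2 :: real) powr (1 - real 2) = 1 / 2" by (simp add: powr_minus_divide)
  then show ?case using cube_free_bound_2 by simp
next
  case (step d)
  define e :: real where "e = 2 powr (1 - real (Suc d))"
  have "2 powr (1 - real d) = 2 * e"
    by (simp add: e_def powr_diff powr_minus_divide)
  moreover have "e \<le> 1 / 4"
  proof -
    have "e \<le> 2 powr (- 2)" unfolding e_def using step by (intro powr_mono) auto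
    then show ?thesis by (simp add: powr_minus_divide)
  qed
  ultimately show ?case
    using cube_free_bound_Suc[of d e] step.IH by (simp add: e_def)
qed

theorem corollary1:
  fixes d n :: nat and F :: "nat set set"
  assumes "d \<ge> 3"
    and "real n \<ge> (2 ^ d - 2 / ln 2)\<^sup>2"
    and "F \<subseteq> Pow {1..n}"
    and "\<not> contains_boolean_algebra n d F"
  shows "lubell n F \<le> 2 * (real n + 1) powr (1 - 2 powr (1 - real d))"
proof -
  have "\<not> has_cube d F" using contains_boolean_algebra_if_has_cube assms(3,4) by blast
  moreover have "d \<ge> 2" using assms(1) by simp
  ultimately have "expected_chain_sum (indicator F) {1..n}
      \<le> 2 * (real (card {1..n}) + 1) powr (1 - 2 powr (1 - real d))"
    using cube_free_bound_ge_2[of d] unfolding cube_free_bound_def by blast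
  then show ?thesis using lubell_eq_expected_chain_sum[OF assms(3)] by simp
qed

end
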